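(* Let $H_1,H_2$ be real Hilbert spaces, $C:H_1\to H_2$ a bounded linear mapping with adjoint $C^T:H_2\to H_1$, and $\mathcal{M}:H_2\rightrightarrows H_2$ a maximal monotone operator. Let Algorithm 1 be the following iteration: given $\lambda>0$ and $y\in H_1$, choose $\mu>0$ such that $\lambda\mu\in(0,2/\|C\|^2)$ and $(\alpha_k)\subset(0,1)$ with $\sum_{k=1}^\infty\alpha_k(1-\alpha_k)=\infty$, and set $$v_0\in H_2,\qquad v_{k+1}=(1-\alpha_k)v_k+\alpha_k\mathcal{N}(v_k),\quad k=0,1,2,\ldots,$$ where $$\mathcal{N}(v):=\mathcal{M}_{\frac1\mu}\Big(Cy+\big(\tfrac1\mu I-\lambda CC^T\big)v\Big).$$ If $\|I-\lambda\mu CC^T\|<1$, then Algorithm 1 converges with linear rate. Particularly, if $E:=CC^T$ is positive definite, one can choose $\lambda>0$, $\mu>0$ such that the convergence rate of Algorithm 1 is linear.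
   Context: The resolvent of $\alpha\mathcal{M}$ is $J_{\alpha\mathcal{M}}=(I+\alpha\mathcal{M})^{-1}$, and the Yosida approximation of $\mathcal{M}$ of index $\alpha>0$ is the single-valued map $\mathcal{M}_\alpha=\frac1\alpha(I-J_{\alpha\mathcal{M}})=(\alpha I+\mathcal{M}^{-1})^{-1}$. A bounded linear $E:H_2\to H_2$ is positive definite if there is $c>0$ with $\langle Ex,x\rangle\ge c\|x\|^2$ for all $x\in H_2$.
   Formalization: A linear rate fails if α_k→0 (e.g. C=M=I on R, α_k=1/(k+2)). Proved: for all admissible (α_k), v_k converges to a fixed point w of N with |v_{k+1}-w| ≤ (1-(1-q)α_k)|v_k-w| for one q<1, and the rate is linear when inf α_k>0. *)

theory Defs
  imports "HOL-Analysis.Analysis"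
begin

text \<open>Set-valued operators \<open>M : H \<rightrightarrows> H\<close> are functions \<open>'a \<Rightarrow> 'a set\<close>; a point is outside the
  domain of \<open>M\<close> iff its value is \<open>{}\<close>.\<close>

definition monotone_operator :: "('a::real_inner \<Rightarrow> 'a set) \<Rightarrow> bool" where
  "monotone_operator M \<longleftrightarrow>
     (\<forall>x y. \<forall>u\<in>M x. \<forall>v\<in>M y. 0 \<le> (u - v) \<bullet> (x - y))"

definition maximal_monotone :: "('a::real_inner \<Rightarrow> 'a set) \<Rightarrow> bool" where
  "maximal_monotone M \<longleftrightarrow> monotone_operator M \<and>
     (\<forall>M'. monotone_operator M' \<and> (\<forall>x. M x \<subseteq> M' x) \<longrightarrow> M' = M)"

definition inverse_operator :: "('a \<Rightarrow> 'b set) \<Rightarrow> 'b \<Rightarrow> 'a set" where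
  "inverse_operator M u = {x. u \<in> M x}"

definition resolvent_operator :: "real \<Rightarrow> ('a::real_inner \<Rightarrow> 'a set) \<Rightarrow> 'a \<Rightarrow> 'a set" where
  "resolvent_operator a M = inverse_operator (\<lambda>x. (\<lambda>u. x + a *\<^sub>R u) ` M x)"

text \<open>The resolvent of a maximal monotone operator on a Hilbert space is single-valued and
  everywhere defined when \<open>a > 0\<close>, so \<^const>\<open>the_elem\<close> then picks its only value.\<close>

definition yosida :: "real \<Rightarrow> ('a::real_inner \<Rightarrow> 'a set) \<Rightarrow> 'a \<Rightarrow> 'a" where
  "yosida a M x = (1 / a) *\<^sub>R (x - the_elem (resolvent_operator a M x))"

definition positive_definite :: "('a::real_inner \<Rightarrow> 'a) \<Rightarrow> bool" where
  "positive_definite E \<longleftrightarrow> (\<exists>c>0. \<forall>x. E x \<bullet> x \<ge> c * (norm x)\<^sup>2)"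

definition alg_map ::
  "('a::real_inner \<Rightarrow> 'b::real_inner) \<Rightarrow> ('b \<Rightarrow> 'b set) \<Rightarrow> real \<Rightarrow> real \<Rightarrow> 'a \<Rightarrow> 'b \<Rightarrow> 'b" where
  "alg_map C M lam mu y v =
     yosida (1 / mu) M (C y + ((1 / mu) *\<^sub>R v - lam *\<^sub>R C (adjoint C v)))"

primrec alg_seq :: "('b::real_vector \<Rightarrow> 'b) \<Rightarrow> (nat \<Rightarrow> real) \<Rightarrow> 'b \<Rightarrow> nat \<Rightarrow> 'b" where
  "alg_seq N \<alpha> v0 0 = v0"
| "alg_seq N \<alpha> v0 (Suc k) =
     (1 - \<alpha> k) *\<^sub>R alg_seq N \<alpha> v0 k + \<alpha> k *\<^sub>R N (alg_seq N \<alpha> v0 k)"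

text \<open>The bound \<open>\<lambda>\<mu> < 2 / \<parallel>C\<parallel>\<^sup>2\<close> is written without division, so that it imposes
  no upper bound when \<open>C = 0\<close> (in HOL, \<open>2 / 0 = 0\<close>).\<close>

definition admissible_parameters ::
  "('a::real_normed_vector \<Rightarrow> 'b::real_normed_vector) \<Rightarrow> real \<Rightarrow> real \<Rightarrow> bool" where
  "admissible_parameters C lam mu \<longleftrightarrow>
     lam > 0 \<and> mu > 0 \<and> lam * mu * (onorm C)\<^sup>2 < 2"

definition admissible_steps :: "(nat \<Rightarrow> real) \<Rightarrow> bool" where
  "admissible_steps \<alpha> \<longleftrightarrow> (\<forall>k. 0 < \<alpha> k \<and> \<alpha> k < 1) \<and>
     filterlim (\<lambda>n. \<Sum>k=1..n. \<alpha> k * (1 - \<alpha> k)) at_top sequentially"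

definition converges_linearly :: "(nat \<Rightarrow> 'a::real_normed_vector) \<Rightarrow> 'a \<Rightarrow> bool" where
  "converges_linearly X L \<longleftrightarrow> X \<longlonglongrightarrow> L \<and>
     (\<exists>r. 0 \<le> r \<and> r < 1 \<and> (\<forall>k. norm (X (Suc k) - L) \<le> r * norm (X k - L)))"

text \<open>If \<open>N\<close> is a contraction with constant \<open>q\<close>, one relaxed step with parameter \<open>\<alpha> k\<close>
  contracts by \<open>1 - (1 - q) * \<alpha> k\<close>. The condition on the steps in \<^const>\<open>admissible_steps\<close>
  allows \<open>\<alpha> k \<longlonglongrightarrow> 0\<close>, and then no \<open>r < 1\<close> need bound all these factors:
  for \<open>\<alpha> k = 1 / (k + 2)\<close> and \<open>N v = v / 2\<close> on the reals, the error decays only polynomially.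
  Hence the definition below asks, for all admissible steps, for convergence with these
  factors for a single \<open>q < 1\<close>, and for linear convergence in the usual sense if the steps
  are bounded away from \<open>0\<close>.\<close>

definition algorithm_linear_rate ::
  "('a::real_inner \<Rightarrow> 'b::real_inner) \<Rightarrow> ('b \<Rightarrow> 'b set) \<Rightarrow> real \<Rightarrow> real \<Rightarrow> 'a \<Rightarrow> bool" where
  "algorithm_linear_rate C M lam mu y \<longleftrightarrow>
     (\<exists>w q. alg_map C M lam mu y w = w \<and> 0 \<le> q \<and> q < 1 \<and>
        (\<forall>v0 \<alpha>. admissible_steps \<alpha> \<longrightarrow>
           (let v = alg_seq (alg_map C M lam mu y) \<alpha> v0 in
              v \<longlonglongrightarrow> w \<and>
              (\<forall>k. norm (v (Suc k) - w) \<le> (1 - (1 - q) * \<alpha> k) * norm (v k - w)) \<and>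
              ((\<exists>a>0. \<forall>k. a \<le> \<alpha> k) \<longrightarrow> converges_linearly v w))))"

end

theory Submission
  imports Defs
begin

text \<open>
  For a maximal monotone \<open>M\<close> and \<open>a > 0\<close>, every point \<open>x\<close> splits uniquely as \<open>x = z + a u\<close> with
  \<open>u \<in> M z\<close>, and the Yosida approximation sends \<open>x\<close> to \<open>u\<close>. Monotonicity gives
  \<open>a \<parallel>u - u'\<parallel>\<^sup>2 \<le> \<langle>x - x', u - u'\<rangle>\<close>, so this map is Lipschitz with constant \<open>1 / a\<close>. For \<open>a = 1 / \<mu>\<close>
  the constant is \<open>\<mu>\<close>, which cancels the factor \<open>1 / \<mu>\<close> in
  \<open>C y + (1 / \<mu>) (I - \<lambda>\<mu> C C\<^sup>T) v\<close>. Hence the map iterated by the algorithm is Lipschitz with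
  constant \<open>q = \<parallel>I - \<lambda>\<mu> C C\<^sup>T\<parallel>\<close> (\<open>alg_map_lipschitz\<close>). If \<open>q < 1\<close>, Banach's theorem provides the fixed
  point, a relaxed step contracts the error by \<open>1 - (1 - q) \<alpha>\<^sub>k\<close>, and the product of these factors
  tends to \<open>0\<close> because it is at most \<open>exp (- (1 - q) (\<Sum> \<alpha>\<^sub>k))\<close> and \<open>\<Sum> \<alpha>\<^sub>k\<close> diverges.

  If \<open>C C\<^sup>T\<close> is positive definite, expanding \<open>\<parallel>v - t C C\<^sup>T v\<parallel>\<^sup>2\<close> shows that a small \<open>t = \<lambda>\<mu>\<close> makes
  \<open>I - t C C\<^sup>T\<close> a strict contraction (\<open>positive_definite_contraction\<close>).

  Two facts about Hilbert spaces carry the argument: \<open>C\<close> has an adjoint, which is Riesz's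
  representation theorem, and the splitting of \<open>x\<close> exists, which is Minty's theorem. Both follow from
  one minimisation principle, \<open>strongly_convex_minimum\<close>. Adding \<open>\<parallel>p\<parallel>\<^sup>2 / 2\<close> to a convex function makes
  minimising sequences Cauchy, so completeness alone yields the minimiser, without weak compactness.
  For Riesz the convex function is \<open>- f\<close>; for Minty it is the Fitzpatrick function of the operator.
\<close>

section \<open>Minimising a strongly convex function\<close>

lemma midpoint_norm_square:
  fixes p q :: "'h::real_inner"
  shows "(norm (p - q))\<^sup>2
    = 2 * (norm p)\<^sup>2 + 2 * (norm q)\<^sup>2 - 4 * (norm ((1/2) *\<^sub>R (p + q)))\<^sup>2"
  by (simp add: power2_norm_eq_inner inner_simps inner_commute algebra_simps)

text \<open>
  The set \<open>K\<close> plays the role of the epigraph of a lower semicontinuous convex function \<open>g\<close>, and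
  \<open>g p + \<parallel>p\<parallel>\<^sup>2 / 2\<close> is minimised. Working with the epigraph keeps all values real where \<open>g\<close> would be
  \<open>\<infinity>\<close>. The conclusion is the variational inequality \<open>0 \<le> g q - g p + \<langle>p, q - p\<rangle>\<close>, obtained from the
  derivative at the minimiser along the segment towards \<open>q\<close>.
\<close>
theorem strongly_convex_minimum:
  fixes K :: "('h::{real_inner,complete_space} \<times> real) set"
  assumes "convex K" "closed K" "K \<noteq> {}"
    and lower: "\<And>p s. (p, s) \<in> K \<Longrightarrow> b \<le> s + (norm p)\<^sup>2 / 2"
  obtains p s where "(p, s) \<in> K"
    and "\<And>q r. (q, r) \<in> K \<Longrightarrow> s + p \<bullet> p \<le> r + p \<bullet> q"
proof -
  define J where "J = (\<lambda>z::'h \<times> real. snd z + (norm (fst z))\<^sup>2 / 2)"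
  define m where "m = Inf (J ` K)"
  have bdd: "bdd_below (J ` K)"
    using lower by (intro bdd_belowI2[where m = b]) (auto simp: J_def)
  have m_le: "m \<le> J z" if "z \<in> K" for z
    unfolding m_def using bdd that by (rule cINF_lower)
  have "\<exists>z\<in>K. J z < m + inverse (real (Suc n))" for n
    using cInf_lessD[of "J ` K" "m + inverse (real (Suc n))"] assms(3)
    by (auto simp: m_def)
  then obtain z where zK: "\<And>n. z n \<in> K"
    and zJ: "\<And>n. J (z n) < m + inverse (real (Suc n))" by metis
  have zlim: "(\<lambda>n. J (z n)) \<longlonglongrightarrow> m"
  proof (rule tendsto_sandwich[where f = "\<lambda>_. m" and h = "\<lambda>n. m + inverse (real (Suc n))"])
    show "(\<lambda>n. m + inverse (real (Suc n))) \<longlonglongrightarrow> m"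
      using tendsto_add[OF tendsto_const LIMSEQ_inverse_real_of_nat, of m] by simp
  qed (use m_le[OF zK] zJ in \<open>auto intro!: always_eventually less_imp_le\<close>)
  \<comment> \<open>The objective at the midpoint is at least the infimum, so by the parallelogram law points with
    nearly minimal objective are close to each other.\<close>
  have close: "(norm (fst (z i) - fst (z j)))\<^sup>2 \<le> 4 * (J (z i) + J (z j) - 2 * m)" for i j
  proof -
    have "(1/2) *\<^sub>R z i + (1/2) *\<^sub>R z j \<in> K"
      using \<open>convex K\<close> zK by (auto intro: convexD)
    from m_le[OF this] have "m \<le> (snd (z i) + snd (z j)) / 2
        + (norm ((1/2) *\<^sub>R (fst (z i) + fst (z j))))\<^sup>2 / 2"
      by (simp add: J_def scaleR_add_right add_divide_distrib)
    then show ?thesis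
      unfolding J_def midpoint_norm_square add_divide_distrib by argo
  qed
  have "Cauchy (\<lambda>n. fst (z n))"
    unfolding Cauchy_iff
  proof (intro allI impI)
    fix e :: real assume "e > 0"
    then have "\<forall>\<^sub>F n in sequentially. J (z n) < m + e\<^sup>2 / 8"
      by (intro order_tendstoD(2)[OF zlim]) simp
    then obtain N where N: "\<And>n. n \<ge> N \<Longrightarrow> J (z n) < m + e\<^sup>2 / 8"
      by (auto simp: eventually_sequentially)
    have "norm (fst (z i) - fst (z j)) < e" if "i \<ge> N" "j \<ge> N" for i j
    proof (rule power_less_imp_less_base)
      show "(norm (fst (z i) - fst (z j)))\<^sup>2 < e\<^sup>2"
        using close[of i j] N[OF that(1)] N[OF that(2)] by simp
    qed (use \<open>e > 0\<close> in simp)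
    then show "\<exists>N. \<forall>i\<ge>N. \<forall>j\<ge>N. norm (fst (z i) - fst (z j)) < e" by blast
  qed
  then obtain p where p: "(\<lambda>n. fst (z n)) \<longlonglongrightarrow> p"
    using Cauchy_convergent convergent_def by blast
  \<comment> \<open>The heights converge although nothing bounds them directly: the objective and the norms of the
    base points do.\<close>
  define s where "s = m - (norm p)\<^sup>2 / 2"
  have "(\<lambda>n. J (z n) - (norm (fst (z n)))\<^sup>2 / 2) \<longlonglongrightarrow> s"
    unfolding s_def by (intro tendsto_intros zlim p) simp
  then have "(\<lambda>n. snd (z n)) \<longlonglongrightarrow> s" by (simp add: J_def)
  with p have "(\<lambda>n. (fst (z n), snd (z n))) \<longlonglongrightarrow> (p, s)" by (rule tendsto_Pair)
  then have psK: "(p, s) \<in> K"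
    using closed_sequentially[OF \<open>closed K\<close>, of z "(p, s)"] zK by simp
  moreover have "s + p \<bullet> p \<le> r + p \<bullet> q" if "(q, r) \<in> K" for q r
  proof -
    define D where "D = r - s + p \<bullet> (q - p)"
    have slope: "0 \<le> D + t * ((norm (q - p))\<^sup>2 / 2)" if t: "0 < t" "t < 1" for t
    proof -
      have "(1 - t) *\<^sub>R (p, s) + t *\<^sub>R (q, r) \<in> K"
        using \<open>convex K\<close> psK \<open>(q, r) \<in> K\<close> t by (intro convexD) auto
      moreover have "(1 - t) *\<^sub>R (p, s) + t *\<^sub>R (q, r)
          = (p + t *\<^sub>R (q - p), s + t * (r - s))"
        by (simp add: algebra_simps)
      ultimately have "m \<le> s + t * (r - s) + (norm (p + t *\<^sub>R (q - p)))\<^sup>2 / 2"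
        using m_le by (force simp: J_def)
      also have "(norm (p + t *\<^sub>R (q - p)))\<^sup>2
          = (norm p)\<^sup>2 + 2 * t * (p \<bullet> (q - p)) + t\<^sup>2 * (norm (q - p))\<^sup>2"
        unfolding power2_norm_eq_inner
        by (simp add: inner_add_left inner_add_right inner_commute power2_eq_square)
      finally have "0 \<le> t * (D + t * ((norm (q - p))\<^sup>2 / 2))"
        by (simp add: s_def D_def algebra_simps power2_eq_square add_divide_distrib diff_divide_distrib)
      with t show ?thesis by (simp add: zero_le_mult_iff)
    qed
    have "((\<lambda>t. D + t * ((norm (q - p))\<^sup>2 / 2)) \<longlongrightarrow> D + 0 * ((norm (q - p))\<^sup>2 / 2)) (at_right 0)"
      by (intro tendsto_intros)
    moreover have "\<forall>\<^sub>F t in at_right 0. 0 \<le> D + t * ((norm (q - p))\<^sup>2 / 2)"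
      using eventually_at_right_real[OF zero_less_one] by (rule eventually_mono) (auto dest: slope)
    ultimately have "0 \<le> D + 0 * ((norm (q - p))\<^sup>2 / 2)"
      by (rule tendsto_lowerbound) simp
    then have "0 \<le> D" by simp
    then show ?thesis by (simp add: D_def inner_simps)
  qed
  ultimately show thesis by (rule that)
qed

section \<open>Adjoints in Hilbert spaces\<close>

text \<open>
  Minimise \<open>\<parallel>p\<parallel>\<^sup>2 / 2 - f p\<close>. At the minimiser the variational inequality, applied to \<open>p + h\<close> and
  \<open>p - h\<close>, gives both inequalities between \<open>f h\<close> and \<open>\<langle>p, h\<rangle>\<close>.
\<close>
theorem riesz_representation:
  fixes f :: "'h::{real_inner,complete_space} \<Rightarrow> real"
  assumes "bounded_linear f"
  obtains p where "\<And>x. f x = p \<bullet> x"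
proof -
  interpret f: bounded_linear f by fact
  obtain B where B: "\<And>x. norm (f x) \<le> norm x * B" using f.bounded by blast
  define K where "K = {(p, s). - f p \<le> s}"
  have lower: "- (B\<^sup>2 / 2) \<le> s + (norm p)\<^sup>2 / 2" if "(p, s) \<in> K" for p s
  proof -
    have "0 \<le> (norm p - B)\<^sup>2" by simp
    then have "norm p * B \<le> (norm p)\<^sup>2 / 2 + B\<^sup>2 / 2"
      by (simp add: power2_eq_square algebra_simps)
    with B[of p] that show ?thesis by (simp add: K_def abs_le_iff)
  qed
  have "convex K"
    unfolding K_def convex_def
  proof (clarsimp simp: f.add f.scaleR, goal_cases)
    case (1 p s q r a b)
    then have "a * (- f p) + b * (- f q) \<le> a * s + b * r"
      by (intro add_mono mult_left_mono)
    then show ?case by simp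
  qed
  moreover have "closed K"
    unfolding K_def case_prod_beta
    by (intro closed_Collect_le continuous_intros f.continuous_on)
  moreover have "(0, 0) \<in> K" by (simp add: K_def)
  ultimately obtain p s where ps: "(p, s) \<in> K"
    "\<And>q r. (q, r) \<in> K \<Longrightarrow> s + p \<bullet> p \<le> r + p \<bullet> q"
    using strongly_convex_minimum[of K "- (B\<^sup>2 / 2)"] lower by blast
  have le: "f h \<le> p \<bullet> h" for h
  proof -
    have "- f p \<le> s" using ps(1) by (simp add: K_def)
    moreover have "(p + h, - f (p + h)) \<in> K" by (simp add: K_def)
    from ps(2)[OF this] have "s + f p + f h \<le> p \<bullet> h" by (simp add: f.add inner_simps)
    ultimately show ?thesis by simp
  qed
  have "f h = p \<bullet> h" for h
    using le[of h] le[of "- h"] by (simp add: linear_neg[OF f.linear])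
  then show thesis by (rule that)
qed

text \<open>
  \<^const>\<open>adjoint\<close> is a Hilbert choice of a map satisfying this identity, so the content is that such
  a map exists, which Riesz's theorem provides pointwise in \<open>v\<close>.
\<close>
lemma adjoint_inner:
  fixes C :: "'a::{real_inner,complete_space} \<Rightarrow> 'b::real_inner"
  assumes "bounded_linear C"
  shows "C x \<bullet> v = x \<bullet> adjoint C v"
proof -
  have "\<exists>p. \<forall>x. C x \<bullet> v = x \<bullet> p" for v
  proof -
    have "bounded_linear (\<lambda>x. C x \<bullet> v)"
      using assms by (rule bounded_linear_inner_left_comp)
    then show ?thesis by (metis riesz_representation inner_commute)
  qed
  then have "\<exists>g. \<forall>x v. C x \<bullet> v = x \<bullet> g v" by metis
  from someI_ex[OF this] show ?thesis
    unfolding adjoint_def by blast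
qed

lemma bounded_linear_adjoint:
  fixes C :: "'a::{real_inner,complete_space} \<Rightarrow> 'b::real_inner"
  assumes "bounded_linear C"
  shows "bounded_linear (adjoint C)"
    and norm_adjoint_le: "norm (adjoint C v) \<le> onorm C * norm v"
proof -
  note adj = adjoint_inner[OF assms]
  have bound: "norm (adjoint C v) \<le> onorm C * norm v" for v
  proof (cases "adjoint C v = 0")
    case False
    have "norm (adjoint C v) * norm (adjoint C v) = C (adjoint C v) \<bullet> v"
      by (simp add: adj power2_norm_eq_inner flip: power2_eq_square)
    also have "\<dots> \<le> norm (C (adjoint C v)) * norm v" by (rule norm_cauchy_schwarz)
    also have "\<dots> \<le> (onorm C * norm (adjoint C v)) * norm v"
      by (intro mult_right_mono onorm assms) simp
    finally have "norm (adjoint C v) * norm (adjoint C v) \<le> norm (adjoint C v) * (onorm C * norm v)"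
      by (simp add: mult_ac)
    with False show ?thesis by simp
  qed (simp add: onorm_pos_le assms)
  show "norm (adjoint C v) \<le> onorm C * norm v" by (rule bound)
  show "bounded_linear (adjoint C)"
  proof (rule bounded_linear_intro[where K = "onorm C"])
    fix v w r
    have "x \<bullet> adjoint C (v + w) = x \<bullet> (adjoint C v + adjoint C w)" for x
      by (simp add: inner_add_right flip: adj)
    then show "adjoint C (v + w) = adjoint C v + adjoint C w"
      using vector_eq_ldot by blast
    have "x \<bullet> adjoint C (r *\<^sub>R v) = x \<bullet> (r *\<^sub>R adjoint C v)" for x
      by (simp flip: adj)
    then show "adjoint C (r *\<^sub>R v) = r *\<^sub>R adjoint C v"
      using vector_eq_ldot by blast
    show "norm (adjoint C v) \<le> norm v * onorm C"
      using bound[of v] by (simp add: mult.commute)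
  qed
qed

section \<open>Minty's theorem and the Yosida approximation\<close>

text \<open>Otherwise adding the pair \<open>(z, w)\<close> to the graph would give a proper monotone extension.\<close>
lemma maximal_monotoneD:
  assumes "maximal_monotone M" and rel: "\<And>y v. v \<in> M y \<Longrightarrow> 0 \<le> (w - v) \<bullet> (z - y)"
  shows "w \<in> M z"
proof -
  define M' where "M' = (\<lambda>x. if x = z then insert w (M x) else M x)"
  have mono: "0 \<le> (u - v) \<bullet> (x - y)" if "u \<in> M x" "v \<in> M y" for u v x y
    using assms(1) that unfolding maximal_monotone_def monotone_operator_def by blast
  have rel': "0 \<le> (v - w) \<bullet> (y - z)" if "v \<in> M y" for y v
    using rel[OF that] by (metis inner_minus_left inner_minus_right minus_diff_eq minus_minus)
  have "monotone_operator M'"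
    unfolding monotone_operator_def M'_def by (auto intro: mono rel rel')
  moreover have "\<forall>x. M x \<subseteq> M' x" by (auto simp: M'_def)
  ultimately have "M' = M" using assms(1) unfolding maximal_monotone_def by blast
  moreover have "w \<in> M' z" by (simp add: M'_def)
  ultimately show ?thesis by simp
qed

text \<open>
  Minty's theorem at the point \<open>0\<close>, for an operator given by its graph \<open>G\<close>. The Fitzpatrick function
  \<open>\<phi> (x, u) = Sup {\<langle>x, v\<rangle> + \<langle>y, u\<rangle> - \<langle>y, v\<rangle> | (y, v) \<in> G}\<close> is convex and lower semicontinuous, satisfies
  \<open>\<phi> (x, u) \<ge> \<langle>x, u\<rangle>\<close> by maximality, and equals \<open>\<langle>y, v\<rangle>\<close> on \<open>G\<close> by monotonicity. Hence
  \<open>\<phi> (x, u) + \<parallel>(x, u)\<parallel>\<^sup>2 / 2 \<ge> \<parallel>x + u\<parallel>\<^sup>2 / 2 \<ge> 0\<close>, and a minimiser \<open>(x, u)\<close> exists. Its variational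
  inequality at a point of \<open>G\<close> says that \<open>(- u, - x)\<close> is monotonically related to that point, with the
  excess \<open>\<parallel>x + u\<parallel>\<^sup>2\<close>. So \<open>(- u, - x)\<close> belongs to \<open>G\<close>, and using it as the test point forces
  \<open>x + u = 0\<close>.
\<close>
lemma minty_zero:
  fixes G :: "('h::{real_inner,complete_space} \<times> 'h) set"
  assumes mono: "\<And>x u y v. (x, u) \<in> G \<Longrightarrow> (y, v) \<in> G \<Longrightarrow> 0 \<le> (u - v) \<bullet> (x - y)"
    and max: "\<And>z w. (\<And>y v. (y, v) \<in> G \<Longrightarrow> 0 \<le> (w - v) \<bullet> (z - y)) \<Longrightarrow> (z, w) \<in> G"
  obtains z where "(z, - z) \<in> G"
proof -
  \<comment> \<open>The epigraph of the Fitzpatrick function.\<close>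
  define K where "K = {((x, u), s). \<forall>(y, v)\<in>G. x \<bullet> v + y \<bullet> u - y \<bullet> v \<le> s}"
  have K_iff: "((x, u), s) \<in> K \<longleftrightarrow> (\<forall>y v. (y, v) \<in> G \<longrightarrow> x \<bullet> v + y \<bullet> u - y \<bullet> v \<le> s)" for x u s
    by (auto simp: K_def)
  have above: "x \<bullet> u \<le> s" if "((x, u), s) \<in> K" for x u s
  proof (rule ccontr)
    assume s: "\<not> x \<bullet> u \<le> s"
    have "(x, u) \<in> G"
    proof (rule max)
      fix y v assume "(y, v) \<in> G"
      with that have "x \<bullet> v + y \<bullet> u - y \<bullet> v \<le> s" by (simp add: K_iff)
      with s show "0 \<le> (u - v) \<bullet> (x - y)" by (simp add: inner_simps inner_commute)
    qed
    with that s show False by (force simp: K_iff)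
  qed
  have onG: "((y, v), y \<bullet> v) \<in> K" if "(y, v) \<in> G" for y v
    using mono[OF that] by (auto simp: K_iff inner_simps inner_commute algebra_simps)
  have lower: "0 \<le> s + (norm p)\<^sup>2 / 2" if "(p, s) \<in> K" for p s
  proof -
    obtain x u where p: "p = (x, u)" by force
    have "0 \<le> (x + u) \<bullet> (x + u)" by simp
    then have "0 \<le> x \<bullet> u + (x \<bullet> x + u \<bullet> u) / 2"
      by (simp add: inner_simps inner_commute field_simps)
    with above[of x u s] that show ?thesis
      by (simp add: p power2_norm_eq_inner inner_prod_def)
  qed
  have "K = (\<Inter>(y, v)\<in>G. {((x, u), s). x \<bullet> v + y \<bullet> u - y \<bullet> v \<le> s})"
    by (auto simp: K_def)
  moreover have "convex {((x, u), s). x \<bullet> v + y \<bullet> u - y \<bullet> v \<le> s}" for y v :: 'h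
    unfolding convex_def
  proof (clarsimp, goal_cases)
    case (1 x u s x' u' s' a b)
    from 1 have "a * (x \<bullet> v + y \<bullet> u - y \<bullet> v) + b * (x' \<bullet> v + y \<bullet> u' - y \<bullet> v) \<le> a * s + b * s'"
      by (intro add_mono mult_left_mono)
    moreover have "y \<bullet> v = a * (y \<bullet> v) + b * (y \<bullet> v)"
      using 1 by (simp flip: distrib_right)
    ultimately show ?case by (simp add: inner_simps algebra_simps)
  qed
  moreover have "closed {((x, u), s). x \<bullet> v + y \<bullet> u - y \<bullet> v \<le> s}" for y v :: 'h
    unfolding case_prod_beta
    by (intro closed_Collect_le continuous_intros)
  ultimately have "convex K" "closed K"
    by (auto intro!: convex_INT closed_INT simp: case_prod_beta)
  moreover have "G \<noteq> {}" using max by blast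
  then have "K \<noteq> {}" using onG by fast
  ultimately obtain p s where ps: "(p, s) \<in> K"
    "\<And>q r. (q, r) \<in> K \<Longrightarrow> s + p \<bullet> p \<le> r + p \<bullet> q"
    using strongly_convex_minimum[of K 0] lower by blast
  obtain x u where p: "p = (x, u)" by force
  have s: "x \<bullet> u \<le> s" using above ps(1) p by blast
  have key: "(x + u) \<bullet> (x + u) \<le> (- x - v) \<bullet> (- u - y)" if "(y, v) \<in> G" for y v
  proof -
    have "s + x \<bullet> x + u \<bullet> u \<le> y \<bullet> v + x \<bullet> y + u \<bullet> v"
      using ps(2)[OF onG[OF that]] by (simp add: p inner_prod_def)
    with s show ?thesis by (simp add: inner_simps inner_commute)
  qed
  have G: "(- u, - x) \<in> G"
    by (rule max) (meson key inner_ge_zero order_trans)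
  from key[OF this] have "(x + u) \<bullet> (x + u) \<le> 0" by simp
  then have "x + u = 0" using inner_ge_zero inner_eq_zero_iff by (metis order_antisym)
  then have "- x = - (- u)" by (simp add: neg_eq_iff_add_eq_0)
  with G show thesis using that by metis
qed

text \<open>
  Solving \<open>x \<in> z + a M z\<close> means finding a zero of \<open>z + (a M z - x)\<close>, and \<open>z \<mapsto> a M z - x\<close> is again
  maximal monotone.
\<close>
theorem minty:
  fixes M :: "'h::{real_inner,complete_space} \<Rightarrow> 'h set"
  assumes M: "maximal_monotone M" and a: "a > 0"
  obtains z u where "u \<in> M z" "x = z + a *\<^sub>R u"
proof -
  define G where "G = {(z, a *\<^sub>R u - x) | z u. u \<in> M z}"
  have mono: "0 \<le> (u - v) \<bullet> (y - z)" if "u \<in> M y" "v \<in> M z" for u v y z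
    using M that unfolding maximal_monotone_def monotone_operator_def by blast
  obtain z where "(z, - z) \<in> G"
  proof (rule minty_zero[of G])
    fix y w z w' assume "(y, w) \<in> G" "(z, w') \<in> G"
    then obtain u v where uv: "u \<in> M y" "v \<in> M z" and w: "w = a *\<^sub>R u - x" "w' = a *\<^sub>R v - x"
      by (auto simp: G_def)
    have "(w - w') \<bullet> (y - z) = a * ((u - v) \<bullet> (y - z))"
      by (simp add: w inner_simps algebra_simps)
    then show "0 \<le> (w - w') \<bullet> (y - z)" using a mono[OF uv] by simp
  next
    fix z w assume rel: "\<And>y v. (y, v) \<in> G \<Longrightarrow> 0 \<le> (w - v) \<bullet> (z - y)"
    define u where "u = (1 / a) *\<^sub>R (w + x)"
    have w: "w = a *\<^sub>R u - x" using a by (simp add: u_def)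
    have "u \<in> M z"
    proof (rule maximal_monotoneD[OF M])
      fix y v assume "v \<in> M y"
      then have "0 \<le> (w - (a *\<^sub>R v - x)) \<bullet> (z - y)" by (intro rel) (auto simp: G_def)
      also have "\<dots> = a * ((u - v) \<bullet> (z - y))" by (simp add: w inner_simps algebra_simps)
      finally show "0 \<le> (u - v) \<bullet> (z - y)" using a by (simp add: zero_le_mult_iff)
    qed
    then show "(z, w) \<in> G" using w by (auto simp: G_def)
  qed
  then obtain u where "u \<in> M z" "- z = a *\<^sub>R u - x" by (auto simp: G_def)
  then show thesis by (intro that) (auto simp: algebra_simps)
qed

lemma monotone_cocoercive:
  fixes M :: "'h::real_inner \<Rightarrow> 'h set"
  assumes "monotone_operator M" "u \<in> M z" "v \<in> M y"
  shows "a * (norm (u - v))\<^sup>2 \<le> norm ((z + a *\<^sub>R u) - (y + a *\<^sub>R v)) * norm (u - v)"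
proof -
  have "0 \<le> (u - v) \<bullet> (z - y)" using assms unfolding monotone_operator_def by blast
  then have "a * (norm (u - v))\<^sup>2 \<le> ((z + a *\<^sub>R u) - (y + a *\<^sub>R v)) \<bullet> (u - v)"
    by (simp add: power2_norm_eq_inner inner_simps inner_commute algebra_simps)
  also have "\<dots> \<le> norm ((z + a *\<^sub>R u) - (y + a *\<^sub>R v)) * norm (u - v)"
    by (rule norm_cauchy_schwarz)
  finally show ?thesis .
qed

lemma yosida_unique:
  fixes M :: "'h::real_inner \<Rightarrow> 'h set"
  assumes mono: "monotone_operator M" and a: "a > 0" and u: "u \<in> M z" and x: "x = z + a *\<^sub>R u"
  shows "yosida a M x = u"
proof -
  have "y = z" if v: "v \<in> M y" "x = y + a *\<^sub>R v" for y v
  proof -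
    have "a * (norm (u - v))\<^sup>2 \<le> 0"
      using monotone_cocoercive[OF mono u v(1), of a] x v(2) by simp
    then have "u = v" using a by (simp add: mult_le_0_iff)
    with x v(2) show ?thesis by simp
  qed
  then have "resolvent_operator a M x = {z}"
    using u x unfolding resolvent_operator_def inverse_operator_def by auto
  then show ?thesis using a x by (simp add: yosida_def)
qed

lemma yosida_lipschitz:
  fixes M :: "'h::{real_inner,complete_space} \<Rightarrow> 'h set"
  assumes M: "maximal_monotone M" and a: "a > 0"
  shows "norm (yosida a M x - yosida a M x') \<le> (1 / a) * norm (x - x')"
proof -
  have mono: "monotone_operator M" using M by (simp add: maximal_monotone_def)
  obtain z u where u: "u \<in> M z" "x = z + a *\<^sub>R u" using minty[OF M a] .
  obtain y v where v: "v \<in> M y" "x' = y + a *\<^sub>R v" using minty[OF M a] .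
  have "a * norm (u - v) \<le> norm (x - x')"
  proof (cases "u = v")
    case False
    have "(a * norm (u - v)) * norm (u - v) \<le> norm (x - x') * norm (u - v)"
      using monotone_cocoercive[OF mono u(1) v(1), of a] u(2) v(2)
      by (simp add: power2_eq_square mult_ac)
    with False show ?thesis by simp
  qed simp
  then show ?thesis
    using a yosida_unique[OF mono a u] yosida_unique[OF mono a v]
    by (simp add: field_simps)
qed

section \<open>Relaxed iteration of a contraction\<close>

lemma relaxed_step_contracts:
  fixes N :: "'b::real_normed_vector \<Rightarrow> 'b"
  assumes "norm (N v - w) \<le> q * norm (v - w)" "0 \<le> t" "t \<le> 1"
  shows "norm ((1 - t) *\<^sub>R v + t *\<^sub>R N v - w) \<le> (1 - (1 - q) * t) * norm (v - w)"
proof -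
  have "(1 - t) *\<^sub>R v + t *\<^sub>R N v - w = (1 - t) *\<^sub>R (v - w) + t *\<^sub>R (N v - w)"
    by (simp add: algebra_simps)
  also have "norm \<dots> \<le> (1 - t) * norm (v - w) + t * norm (N v - w)"
    using norm_triangle_ineq[of "(1 - t) *\<^sub>R (v - w)" "t *\<^sub>R (N v - w)"] assms(2,3) by simp
  also have "\<dots> \<le> (1 - t) * norm (v - w) + t * (q * norm (v - w))"
    using assms by (intro add_left_mono mult_left_mono)
  finally show ?thesis by (simp add: algebra_simps)
qed

text \<open>
  Since \<open>\<alpha> k (1 - \<alpha> k) \<le> \<alpha> k\<close> and \<open>1 - x \<le> exp (- x)\<close>, the product of the factors is bounded by the
  exponential of a sum that diverges to \<open>- \<infinity>\<close>.
\<close>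
lemma product_decay_tendsto_zero:
  fixes e :: "nat \<Rightarrow> real"
  assumes steps: "admissible_steps \<alpha>" and "q < 1" and nonneg: "\<And>k. 0 \<le> e k"
    and step: "\<And>k. e (Suc k) \<le> (1 - (1 - q) * \<alpha> k) * e k"
  shows "e \<longlonglongrightarrow> 0"
proof -
  define S where "S = (\<lambda>n. \<Sum>k=1..n. \<alpha> k * (1 - \<alpha> k))"
  have \<alpha>: "0 < \<alpha> k" "\<alpha> k < 1" for k
    using steps by (auto simp: admissible_steps_def)
  have le_exp: "1 - (1 - q) * \<alpha> k \<le> exp (- ((1 - q) * (\<alpha> k * (1 - \<alpha> k))))" for k
  proof -
    have "\<alpha> k * (1 - \<alpha> k) \<le> \<alpha> k" using \<alpha>[of k] by (simp add: mult_le_cancel_left1)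
    then have "(1 - q) * (\<alpha> k * (1 - \<alpha> k)) \<le> (1 - q) * \<alpha> k"
      using \<open>q < 1\<close> by (intro mult_left_mono) auto
    with exp_ge_add_one_self[of "- ((1 - q) * (\<alpha> k * (1 - \<alpha> k)))"] show ?thesis by linarith
  qed
  \<comment> \<open>The sum in the step condition starts at \<open>k = 1\<close>; the factor for \<open>k = 0\<close> is bounded by \<open>1\<close>.\<close>
  have bound: "e (Suc n) \<le> e 0 * exp (- ((1 - q) * S n))" for n
  proof (induction n)
    case 0
    have "e 1 \<le> (1 - (1 - q) * \<alpha> 0) * e 0" using step[of 0] by simp
    also have "\<dots> \<le> 1 * e 0"
      using \<alpha>[of 0] \<open>q < 1\<close> nonneg by (intro mult_right_mono) auto
    finally show ?case by (simp add: S_def)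
  next
    case (Suc n)
    have "e (Suc (Suc n)) \<le> (1 - (1 - q) * \<alpha> (Suc n)) * e (Suc n)" by (rule step)
    also have "\<dots> \<le> exp (- ((1 - q) * (\<alpha> (Suc n) * (1 - \<alpha> (Suc n))))) * e (Suc n)"
      by (intro mult_right_mono le_exp nonneg)
    also have "\<dots> \<le> exp (- ((1 - q) * (\<alpha> (Suc n) * (1 - \<alpha> (Suc n)))))
        * (e 0 * exp (- ((1 - q) * S n)))"
      by (intro mult_left_mono Suc.IH) simp
    also have "\<dots> = e 0 * exp (- ((1 - q) * S (Suc n)))"
    proof -
      have "- ((1 - q) * S (Suc n))
          = - ((1 - q) * (\<alpha> (Suc n) * (1 - \<alpha> (Suc n)))) + - ((1 - q) * S n)"
        by (simp add: S_def distrib_left)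
      then show ?thesis by (simp only: exp_add mult_ac)
    qed
    finally show ?case .
  qed
  have "filterlim S at_top sequentially"
    using steps by (simp add: admissible_steps_def S_def)
  then have "filterlim (\<lambda>n. (1 - q) * S n) at_top sequentially"
    using \<open>q < 1\<close> by (intro filterlim_tendsto_pos_mult_at_top[OF tendsto_const]) auto
  then have "(\<lambda>n. exp (- ((1 - q) * S n))) \<longlonglongrightarrow> 0"
    by (intro filterlim_compose[OF exp_at_bot]) (simp add: filterlim_uminus_at_top)
  then have "(\<lambda>n. e 0 * exp (- ((1 - q) * S n))) \<longlonglongrightarrow> 0"
    by (rule tendsto_mult_right_zero)
  then have "(\<lambda>n. e (Suc n)) \<longlonglongrightarrow> 0"
    by (rule tendsto_sandwich[OF _ _ tendsto_const, rotated 2])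
      (auto intro!: always_eventually nonneg bound)
  then show ?thesis by (rule LIMSEQ_imp_Suc)
qed

section \<open>Linear rate of the algorithm\<close>

text \<open>
  The argument of the Yosida approximation is affine in \<open>v\<close> with linear part
  \<open>(1 / \<mu>) (I - \<lambda>\<mu> C C\<^sup>T)\<close>, and the Lipschitz constant \<open>\<mu>\<close> of the approximation cancels the factor.
\<close>
lemma alg_map_lipschitz:
  fixes C :: "'a::{real_inner,complete_space} \<Rightarrow> 'b::{real_inner,complete_space}"
  assumes C: "bounded_linear C" and M: "maximal_monotone M" and mu: "mu > 0"
  shows "norm (alg_map C M lam mu y v - alg_map C M lam mu y v')
    \<le> onorm (\<lambda>v. v - (lam * mu) *\<^sub>R C (adjoint C v)) * norm (v - v')"
proof -
  define T where "T = (\<lambda>v. v - (lam * mu) *\<^sub>R C (adjoint C v))"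
  interpret E: bounded_linear "\<lambda>v. C (adjoint C v)"
    by (rule bounded_linear_compose[OF C bounded_linear_adjoint(1)[OF C]])
  have T: "bounded_linear T"
    unfolding T_def
    by (intro bounded_linear_sub bounded_linear_ident bounded_linear_const_scaleR
        E.bounded_linear_axioms)
  define x where "x = (\<lambda>v. C y + ((1 / mu) *\<^sub>R v - lam *\<^sub>R C (adjoint C v)))"
  have "x v - x v' = (1 / mu) *\<^sub>R T (v - v')"
    using mu by (simp add: x_def T_def E.diff scaleR_diff_right)
  moreover have "norm (alg_map C M lam mu y v - alg_map C M lam mu y v') \<le> mu * norm (x v - x v')"
    using yosida_lipschitz[OF M, of "1 / mu" "x v" "x v'"] mu by (simp add: alg_map_def x_def)
  ultimately have "norm (alg_map C M lam mu y v - alg_map C M lam mu y v') \<le> norm (T (v - v'))"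
    using mu by simp
  also have "\<dots> \<le> onorm T * norm (v - v')" by (rule onorm[OF T])
  finally show ?thesis by (simp add: T_def)
qed

theorem algorithm_linear_rate_if_contraction:
  fixes C :: "'a::{real_inner,complete_space} \<Rightarrow> 'b::{real_inner,complete_space}"
  assumes C: "bounded_linear C" and M: "maximal_monotone M" and mu: "mu > 0"
    and contr: "onorm (\<lambda>v. v - (lam * mu) *\<^sub>R C (adjoint C v)) < 1"
  shows "algorithm_linear_rate C M lam mu y"
proof -
  define N where "N = alg_map C M lam mu y"
  define q where "q = max 0 (onorm (\<lambda>v. v - (lam * mu) *\<^sub>R C (adjoint C v)))"
  have q: "0 \<le> q" "q < 1" using contr by (auto simp: q_def)
  have N: "norm (N v - N v') \<le> q * norm (v - v')" for v v'
    unfolding N_def q_def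
    by (rule order_trans[OF alg_map_lipschitz[OF C M mu]]) (simp add: mult_right_mono)
  then obtain w where w: "N w = w"
    using banach_fix_type[OF q, of N] by (auto simp: dist_norm)
  have "let v = alg_seq N \<alpha> v0 in v \<longlonglongrightarrow> w \<and>
      (\<forall>k. norm (v (Suc k) - w) \<le> (1 - (1 - q) * \<alpha> k) * norm (v k - w)) \<and>
      ((\<exists>a>0. \<forall>k. a \<le> \<alpha> k) \<longrightarrow> converges_linearly v w)"
    if steps: "admissible_steps \<alpha>" for v0 \<alpha>
  proof -
    define v where "v = alg_seq N \<alpha> v0"
    have \<alpha>: "0 < \<alpha> k" "\<alpha> k < 1" for k
      using steps by (auto simp: admissible_steps_def)
    have step: "norm (v (Suc k) - w) \<le> (1 - (1 - q) * \<alpha> k) * norm (v k - w)" for k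
      using relaxed_step_contracts[of N "v k" w q "\<alpha> k"] N[of "v k" w] w \<alpha>[of k]
      by (simp add: v_def)
    have "(\<lambda>k. norm (v k - w)) \<longlonglongrightarrow> 0"
      by (rule product_decay_tendsto_zero[OF steps q(2) norm_ge_zero step])
    then have lim: "v \<longlonglongrightarrow> w" by (simp add: tendsto_norm_zero_iff LIM_zero_iff)
    have "converges_linearly v w" if a: "a > 0" "\<And>k. a \<le> \<alpha> k" for a
      unfolding converges_linearly_def
    proof (intro conjI exI allI)
      have "(1 - q) * a \<le> 1 * 1"
        using q a(1) a(2)[of 0] \<alpha>(2)[of 0] by (intro mult_mono) auto
      then show "0 \<le> 1 - (1 - q) * a" by simp
      show "1 - (1 - q) * a < 1" using q a by simp
      fix k
      have "1 - (1 - q) * \<alpha> k \<le> 1 - (1 - q) * a"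
        using q a(2)[of k] by (simp add: mult_left_mono)
      then show "norm (v (Suc k) - w) \<le> (1 - (1 - q) * a) * norm (v k - w)"
        by (rule order_trans[OF step mult_right_mono]) simp
    qed (rule lim)
    with lim step show ?thesis unfolding v_def[symmetric] Let_def by blast
  qed
  with w q show ?thesis unfolding algorithm_linear_rate_def N_def by blast
qed

text \<open>
  With \<open>L = \<parallel>C\<parallel>\<^sup>2 \<ge> \<parallel>C C\<^sup>T\<parallel>\<close> and the constant \<open>c\<close> of positive definiteness,
  \<open>\<parallel>v - t C C\<^sup>T v\<parallel>\<^sup>2 \<le> (1 - 2 t c + t\<^sup>2 L\<^sup>2) \<parallel>v\<parallel>\<^sup>2\<close>, and the linear term dominates for small \<open>t\<close>.
\<close>
lemma positive_definite_contraction: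
  fixes C :: "'a::{real_inner,complete_space} \<Rightarrow> 'b::{real_inner,complete_space}"
  assumes C: "bounded_linear C" and pos: "positive_definite (\<lambda>v. C (adjoint C v))"
  obtains t where "t > 0" "t * (onorm C)\<^sup>2 < 2"
    "onorm (\<lambda>v. v - t *\<^sub>R C (adjoint C v)) < 1"
proof -
  define L where "L = (onorm C)\<^sup>2"
  have L: "L \<ge> 0" by (simp add: L_def)
  obtain c where c: "c > 0" "\<And>x. c * (norm x)\<^sup>2 \<le> C (adjoint C x) \<bullet> x"
    using pos unfolding positive_definite_def by blast
  have E: "norm (C (adjoint C x)) \<le> L * norm x" for x
  proof -
    have "norm (C (adjoint C x)) \<le> onorm C * norm (adjoint C x)" by (rule onorm[OF C])
    also have "\<dots> \<le> onorm C * (onorm C * norm x)"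
      by (intro mult_left_mono norm_adjoint_le[OF C] onorm_pos_le[OF C])
    finally show ?thesis by (simp add: L_def power2_eq_square)
  qed
  \<comment> \<open>One choice that meets the three needs \<open>t L < 2\<close>, \<open>t c \<le> 1\<close> and \<open>t L\<^sup>2 \<le> c\<close>; the last halves the
    linear term and leaves the factor \<open>1 - t c\<close>.\<close>
  define t where "t = c / (c + L + 1)\<^sup>2"
  have pos': "(c + L + 1)\<^sup>2 > 0" using c L by simp
  have t: "t > 0" using c pos' by (simp add: t_def)
  have "c * L \<le> (c + L + 1) * (c + L + 1)"
    using c L by (intro mult_mono) auto
  then have "t * L \<le> 1"
    using pos' by (simp add: t_def pos_divide_le_eq power2_eq_square)
  then have tL: "t * L < 2" by simp
  have "c * c \<le> (c + L + 1) * (c + L + 1)"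
    using c L by (intro mult_mono) auto
  then have tc: "t * c \<le> 1"
    using pos' by (simp add: t_def pos_divide_le_eq power2_eq_square)
  have "L\<^sup>2 \<le> (c + L + 1)\<^sup>2"
    using c L by (intro power_mono) auto
  then have tL2: "t * L\<^sup>2 \<le> c"
    using pos' c by (simp add: t_def pos_divide_le_eq)
  have "norm (v - t *\<^sub>R C (adjoint C v)) \<le> sqrt (1 - t * c) * norm v" for v
  proof (rule power2_le_imp_le)
    have "(norm (v - t *\<^sub>R C (adjoint C v)))\<^sup>2
        = (norm v)\<^sup>2 - 2 * t * (C (adjoint C v) \<bullet> v) + t\<^sup>2 * (norm (C (adjoint C v)))\<^sup>2"
      unfolding power2_norm_eq_inner
      by (simp add: inner_diff_left inner_diff_right inner_commute power2_eq_square)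
    also have "\<dots> \<le> (norm v)\<^sup>2 - 2 * t * (c * (norm v)\<^sup>2) + t\<^sup>2 * (L * norm v)\<^sup>2"
      using t by (intro add_mono diff_left_mono mult_left_mono power_mono c E) auto
    also have "\<dots> = (1 - 2 * t * c + t * (t * L\<^sup>2)) * (norm v)\<^sup>2"
      by (simp add: power2_eq_square algebra_simps)
    also have "\<dots> \<le> (1 - 2 * t * c + t * c) * (norm v)\<^sup>2"
      using t tL2 by (intro mult_right_mono add_left_mono mult_left_mono) auto
    also have "\<dots> = (sqrt (1 - t * c) * norm v)\<^sup>2"
      using tc by (simp add: power_mult_distrib)
    finally show "(norm (v - t *\<^sub>R C (adjoint C v)))\<^sup>2 \<le> (sqrt (1 - t * c) * norm v)\<^sup>2" .
  qed (use tc in simp)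
  then have "onorm (\<lambda>v. v - t *\<^sub>R C (adjoint C v)) \<le> sqrt (1 - t * c)"
    using tc by (intro onorm_bound) auto
  also have "\<dots> < 1" using t c by simp
  finally show thesis using that t tL by (simp add: L_def)
qed

theorem theorem9:
  fixes C :: "'a::{real_inner,complete_space} \<Rightarrow> 'b::{real_inner,complete_space}"
    and M :: "'b \<Rightarrow> 'b set"
  assumes "bounded_linear C"
    and "maximal_monotone M"
  shows "(\<forall>lam mu y. admissible_parameters C lam mu \<and>
            onorm (\<lambda>v. v - (lam * mu) *\<^sub>R C (adjoint C v)) < 1 \<longrightarrow>
            algorithm_linear_rate C M lam mu y) \<and>
         (positive_definite (\<lambda>v. C (adjoint C v)) \<longrightarrow>
            (\<exists>lam mu. admissible_parameters C lam mu \<and>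
               (\<forall>y. algorithm_linear_rate C M lam mu y)))"
proof (intro conjI allI impI)
  fix lam mu :: real and y :: 'a
  assume "admissible_parameters C lam mu \<and>
    onorm (\<lambda>v. v - (lam * mu) *\<^sub>R C (adjoint C v)) < 1"
  then show "algorithm_linear_rate C M lam mu y"
    using algorithm_linear_rate_if_contraction[OF assms]
    by (simp add: admissible_parameters_def)
next
  assume "positive_definite (\<lambda>v. C (adjoint C v))"
  then obtain t where t: "t > 0" "t * (onorm C)\<^sup>2 < 2"
    "onorm (\<lambda>v. v - t *\<^sub>R C (adjoint C v)) < 1"
    using positive_definite_contraction[OF assms(1)] by blast
  then have "admissible_parameters C t 1"
    by (simp add: admissible_parameters_def)
  moreover have "algorithm_linear_rate C M t 1 y" for y
    using algorithm_linear_rate_if_contraction[OF assms, of 1 t] t by simp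
  ultimately show "\<exists>lam mu. admissible_parameters C lam mu \<and>
      (\<forall>y. algorithm_linear_rate C M lam mu y)" by blast
qed

end
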